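(* Let $\theta_0,\Phi_0,\Gamma_0,u_0$, the estimators $\Gamma_n,\Phi_n,u_n$ with $u_n\to u_0$ in probability, the generalized Grenander-type estimator $\theta_n$, and the sets $J_0$, $J_n$, $I_n$, $I_{n,\beta}$ be as defined in the context. (1) Suppose $\theta_0$ is continuous at $x\in I$ and, for some $\delta>0$ such that $[x-\delta,x+\delta]\subset\Phi_0^{-1}(J_0)$, $\Phi_0$ is strictly increasing and continuous on $[x-\delta,x+\delta]$. If $\|\Gamma_n-\Gamma_0\|_{\infty,I_n}$, $\|\Phi_n-\Phi_0\|_{\infty,I_n}$ and $\|\Phi_n-\Phi_0\|_{\infty,[x-\delta,x+\delta]}$ tend to zero in probability, then $\theta_n(x)\to\theta_0(x)$ in probability. (2) Suppose $\theta_0$ and $\Phi_0$ are uniformly continuous on $I$, and $\Phi_0$ is strictly increasing on $I$. If $\|\Gamma_n-\Gamma_0\|_{\infty,I_n}$ and $\|\Phi_n-\Phi_0\|_{\infty,I}$ tend to zero in probability, then $\|\theta_n-\theta_0\|_{\infty,I_{n,\beta}}\to 0$ in probability for each fixed $\beta>0$.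
   Context: For an interval $I\subseteq\mathbb{R}$, $\ell^\infty(I)$ is the space of bounded real functions on $I$; $\mathscr{D}_I\subset\ell^\infty(I)$ is the subset of non-decreasing càdlàg functions; $\mathscr{D}_{I,J}\subset\mathscr{D}_I$ is the subset of functions with range contained in the interval $J$. For $G\in\ell^\infty(I)$, $\mathrm{GCM}_I(G)$ (greatest convex minorant) is the pointwise supremum of all convex functions $H\le G$ on $I$. For $G\in\mathscr{D}_I$, the generalized inverse is $G^-(x):=\inf\{u\in I:G(u)\ge x\}$. $\partial_-$ denotes left derivative. $\|f\|_{\infty,S}:=\sup_{s\in S}|f(s)|$. For an interval $J$, $\Psi\in\ell^\infty(J)$ and $\Phi\in\mathscr{D}_{I,J}$, set $\mathrm{Iso}_J(\Psi,\Phi):=(\partial_-\mathrm{GCM}_J(\Psi))\circ\Phi$. Setting: $I\subseteq\mathbb{R}$ is an interval, $\theta_0\in\mathscr{D}_I$ is the unknown function of interest (determined by the true distribution $P_0$), $u_0\in(0,\infty)$, $J_0:=[0,u_0]$, $\Phi_0\in\mathscr{D}_{I,J_0}$ is a domain transform, $\psi_0:=\theta_0\circ\Phi_0^-$, $\Psi_0(t):=\int_0^t\psi_0(u)\,du$ for $t\in J_0$, and $\Gamma_0:=\Psi_0\circ\Phi_0$. For each sample size $n$, $u_n$, $\Phi_n$ and $\Gamma_n$ are random estimators of $u_0$, $\Phi_0$, $\Gamma_0$, with $u_n\to u_0$ in probability, $J_n:=[0,u_n]$, $\Phi_n\in\mathscr{D}_{I,J_n}$, and the estimator of $\theta_0$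 is $$\theta_n:=\mathrm{Iso}_{J_n}(\Gamma_n\circ\Phi_n^-,\Phi_n).$$ Define $I_n:=\{z\in I: z=\Phi_n^-(u),\ u\in J_n\}$ and, for $\beta\ge0$, $I_{n,\beta}:=\{x\in I:0\le\Phi_0(x-\beta)\le\Phi_0(x+\beta)\le u_n\}$ (in particular $x\pm\beta\in I$).
   Formalization: Conditions added as the claim fails without them: in (1), θ_0(x) ≥ 0 or ‖Φ_n∘Φ_n^- − Id‖_∞ → 0 in probability (where defined); in (2), I bounded, and θ_0 ≥ 0 on I or Φ_0 = 0 at the least point of I (if any). GCM is taken over the part of J_n where Φ_n^- lies in I. *)

theory Defs
  imports "HOL-Probability.Probability"
begin

definition bounded_funs :: "real set \<Rightarrow> (real \<Rightarrow> real) set" where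
  "bounded_funs I = {f. bounded (f ` I)}"

definition cadlag_mono :: "real set \<Rightarrow> (real \<Rightarrow> real) set" where
  "cadlag_mono I = {f \<in> bounded_funs I. mono_on I f \<and>
     (\<forall>x\<in>I. continuous (at x within (I \<inter> {x..})) f \<and>
            (\<exists>l. (f \<longlongrightarrow> l) (at x within (I \<inter> {..<x}))))}"

definition cadlag_mono_into :: "real set \<Rightarrow> real set \<Rightarrow> (real \<Rightarrow> real) set" where
  "cadlag_mono_into I J = {f \<in> cadlag_mono I. f ` I \<subseteq> J}"

text \<open>On \<open>J\<close> the set below is bounded above by \<open>G t\<close>, and it is nonempty when \<open>G\<close> is
  bounded on the convex set \<open>J\<close>, so that the real supremum is the intended one.\<close>

definition gcm :: "real set \<Rightarrow> (real \<Rightarrow> real) \<Rightarrow> real \<Rightarrow> real" where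
  "gcm J G t = Sup {H t | H. convex_on J H \<and> (\<forall>s\<in>J. H s \<le> G s)}"

definition left_deriv :: "(real \<Rightarrow> real) \<Rightarrow> real \<Rightarrow> real" where
  "left_deriv f t = (THE d. (f has_real_derivative d) (at_left t))"

text \<open>The generalized inverse is extended-real valued: the infimum is \<open>\<infinity>\<close> if \<open>G\<close> does not reach
  the level \<open>y\<close> on \<open>I\<close>, and it may be \<open>-\<infinity>\<close>, or an endpoint not belonging to \<open>I\<close>.\<close>

definition gen_inv :: "real set \<Rightarrow> (real \<Rightarrow> real) \<Rightarrow> real \<Rightarrow> ereal" where
  "gen_inv I G y = (INF v\<in>{v\<in>I. y \<le> G v}. ereal v)"

definition comp_inv :: "real set \<Rightarrow> (real \<Rightarrow> real) \<Rightarrow> (real \<Rightarrow> real) \<Rightarrow> real \<Rightarrow> real" where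
  "comp_inv I f G y = f (real_of_ereal (gen_inv I G y))"

text \<open>A composite of a function on \<open>I\<close> with the generalized inverse of \<open>G\<close> makes sense at those
  levels \<open>y\<close> whose generalized inverse lies in \<open>I\<close>. For \<open>G\<close> monotone and \<open>J\<close> an interval,
  \<open>inv_dom I J G\<close> is again an interval, and it is \<open>J\<close> itself if the composite is defined on all of \<open>J\<close>.\<close>

definition inv_dom :: "real set \<Rightarrow> real set \<Rightarrow> (real \<Rightarrow> real) \<Rightarrow> real set" where
  "inv_dom I J G = {y\<in>J. gen_inv I G y \<in> ereal ` I}"

definition inv_range :: "real set \<Rightarrow> real set \<Rightarrow> (real \<Rightarrow> real) \<Rightarrow> real set" where
  "inv_range I J G = {z\<in>I. \<exists>y\<in>J. ereal z = gen_inv I G y}"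

definition Iso :: "real set \<Rightarrow> (real \<Rightarrow> real) \<Rightarrow> (real \<Rightarrow> real) \<Rightarrow> real \<Rightarrow> real" where
  "Iso J \<Psi> \<Phi> = left_deriv (gcm J \<Psi>) \<circ> \<Phi>"

text \<open>At a level where the generalized inverse of \<open>\<Phi>\<close> leaves \<open>I\<close>, the integrand takes a value of
  \<open>\<theta>\<close> outside \<open>I\<close>. Below \<open>t = \<Phi> x\<close> with \<open>x \<in> I\<close> such levels lie below all values of \<open>\<Phi>\<close> on \<open>I\<close>
  (up to a null set), and the integrand is constant there; hence they contribute at most an additive
  constant to \<open>primitive_fun I \<theta> \<Phi> \<circ> \<Phi>\<close> on \<open>I\<close>, and nothing if \<open>\<Phi>\<close> has infimum \<open>0\<close>.\<close>

definition primitive_fun :: "real set \<Rightarrow> (real \<Rightarrow> real) \<Rightarrow> (real \<Rightarrow> real) \<Rightarrow> real \<Rightarrow> real" where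
  "primitive_fun I \<theta> \<Phi> t = integral {0..t} (comp_inv I \<theta> \<Phi>)"

definition grenander :: "real set \<Rightarrow> real set \<Rightarrow> (real \<Rightarrow> real) \<Rightarrow> (real \<Rightarrow> real) \<Rightarrow> real \<Rightarrow> real" where
  "grenander I J \<Gamma> \<Phi> = Iso (inv_dom I J \<Phi>) (comp_inv I \<Gamma> \<Phi>) \<Phi>"

definition inner_set :: "real set \<Rightarrow> (real \<Rightarrow> real) \<Rightarrow> real \<Rightarrow> real \<Rightarrow> real set" where
  "inner_set I \<Phi> u \<beta> = {x\<in>I. x - \<beta> \<in> I \<and> x + \<beta> \<in> I \<and>
     0 \<le> \<Phi> (x - \<beta>) \<and> \<Phi> (x - \<beta>) \<le> \<Phi> (x + \<beta>) \<and> \<Phi> (x + \<beta>) \<le> u}"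

text \<open>Valued in \<open>ennreal\<close>: the supremum is \<open>\<infinity>\<close> for an unbounded function, and \<open>0\<close> over the empty set.\<close>

definition sup_norm_on :: "real set \<Rightarrow> (real \<Rightarrow> real) \<Rightarrow> ennreal" where
  "sup_norm_on S f = (SUP s\<in>S. ennreal \<bar>f s\<bar>)"

text \<open>Convergence to zero in (outer) probability. Suprema over uncountable, random index sets need
  not be measurable; for measurable \<open>X n\<close> this is ordinary convergence in probability.\<close>

definition null_in_prob :: "(nat \<Rightarrow> 'a measure) \<Rightarrow> (nat \<Rightarrow> 'a \<Rightarrow> ennreal) \<Rightarrow> bool" where
  "null_in_prob M X \<longleftrightarrow>
     (\<forall>\<epsilon>>0::real. (\<lambda>n. outer_measure_of (M n) {\<omega>\<in>space (M n). ennreal \<epsilon> < X n \<omega>}) \<longlonglongrightarrow> 0)"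

lemma null_in_prob_measurable:
  assumes "\<And>n. prob_space (M n)" and "\<And>n. X n \<in> borel_measurable (M n)"
  shows "null_in_prob M X \<longleftrightarrow>
     (\<forall>\<epsilon>>0::real. (\<lambda>n. measure (M n) {\<omega>\<in>space (M n). ennreal \<epsilon> < X n \<omega>}) \<longlonglongrightarrow> 0)"
proof -
  have "outer_measure_of (M n) {\<omega>\<in>space (M n). ennreal \<epsilon> < X n \<omega>}
      = ennreal (measure (M n) {\<omega>\<in>space (M n). ennreal \<epsilon> < X n \<omega>})" for n \<epsilon>
  proof -
    interpret prob_space "M n" by (rule assms(1))
    have [measurable]: "X n \<in> borel_measurable (M n)" by (rule assms(2))
    show ?thesis by (simp add: emeasure_eq_measure)
  qed
  then show ?thesis
    unfolding null_in_prob_def by (simp flip: ennreal_0 del: ennreal_0)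
qed

end

theory Submission
  imports Defs
begin

text \<open>All of the probability is a union bound; the estimate is deterministic. The only information
  needed on \<open>\<Gamma>\<^sub>0\<close> is that its increments over \<open>[w, z]\<close> lie between \<open>\<theta>\<^sub>0 w\<close> and \<open>\<theta>\<^sub>0 z\<close> times those of
  \<open>\<Phi>\<^sub>0\<close>. Hence the line of slope \<open>\<theta>\<^sub>0 x\<close> tangent to \<open>\<Psi>\<^sub>0\<close> at \<open>\<Phi>\<^sub>0 x\<close>, lowered by the uniform error, is a convex
  minorant of \<open>\<Gamma>\<^sub>n \<circ> \<Phi>\<^sub>n\<^sup>-\<close>, so it bounds the greatest convex minorant \<open>H\<close> from below at \<open>t = \<Phi>\<^sub>n x\<close>. At the
  levels \<open>\<Phi>\<^sub>n a\<close> and \<open>\<Phi>\<^sub>n b\<close> for \<open>a < x < b\<close> near \<open>x\<close>, \<open>\<Phi>\<^sub>n \<circ> \<Phi>\<^sub>n\<^sup>-\<close> is exactly the identity, and \<open>H\<close> is bounded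
  above by \<open>\<Gamma>\<^sub>n \<circ> \<Phi>\<^sub>n\<^sup>-\<close> there. The left derivative of \<open>H\<close> at \<open>t\<close> lies between the two resulting secant slopes,
  which are close to \<open>\<theta>\<^sub>0 x\<close> as soon as the gaps of \<open>\<Phi>\<^sub>0\<close> dominate the uniform error. Jumps of \<open>\<Phi>\<^sub>n\<close> only
  raise \<open>\<Phi>\<^sub>n \<circ> \<Phi>\<^sub>n\<^sup>-\<close> above the identity, which is harmless for the minorant when \<open>\<theta>\<^sub>0 x \<ge> 0\<close>.\<close>

section \<open>Generalized inverses and convex minorants\<close>

lemma gen_inv_le: "v \<in> I \<Longrightarrow> y \<le> G v \<Longrightarrow> gen_inv I G y \<le> ereal v"
  unfolding gen_inv_def by (rule INF_lower) simp

lemma gen_inv_mono: "y \<le> y' \<Longrightarrow> gen_inv I G y \<le> gen_inv I G y'"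
  unfolding gen_inv_def by (rule INF_superset_mono) auto

lemma gen_inv_ge:
  assumes "mono_on I G" "w \<in> I" "G w < y"
  shows "ereal w \<le> gen_inv I G y"
  unfolding gen_inv_def
proof (rule INF_greatest)
  fix v assume "v \<in> {v \<in> I. y \<le> G v}"
  then have "v \<in> I" "G w < G v" using assms(3) by auto
  then have "\<not> v \<le> w" using assms(1,2) by (auto simp: mono_on_def not_le[symmetric])
  then show "ereal w \<le> ereal v" by simp
qed

lemma ereal_between_interval:
  assumes "is_interval I" "w \<in> I" "z \<in> I" "ereal w \<le> e" "e \<le> ereal z"
  obtains r where "e = ereal r" "r \<in> I" "w \<le> r" "r \<le> z"
proof -
  obtain r where r: "e = ereal r" using assms(4,5) by (cases e) auto
  with assms have "w \<le> r" "r \<le> z" by auto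
  moreover from this have "r \<in> I" using assms(1-3) by (meson mem_is_interval_1_I)
  ultimately show thesis using r that by blast
qed

text \<open>Strictness at \<open>w\<close> keeps the infimum from falling below \<open>w\<close>,
  and \<open>z\<close> belongs to the set whose infimum is taken. The value is therefore finite and
  trapped between two points of the interval \<open>I\<close>.\<close>

lemma gen_inv_between:
  assumes "is_interval I" "mono_on I G" "w \<in> I" "z \<in> I" "G w < y" "y \<le> G z"
  obtains r where "gen_inv I G y = ereal r" "r \<in> I" "w \<le> r" "r \<le> z"
  using ereal_between_interval[OF assms(1,3,4) gen_inv_ge[OF assms(2,3,5)] gen_inv_le[where G = G, OF assms(4,6)]]
  by blast

text \<open>Right-continuity makes the infimum attained: if \<open>G r\<close> were below
  \<open>y\<close>, then \<open>G\<close> would stay below \<open>y\<close> on some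
  \<open>[r, r + d)\<close>, and the infimum would be at least \<open>r + d\<close>.\<close>

lemma le_at_gen_inv:
  assumes cont: "continuous (at r within (I \<inter> {r..})) G" and r: "gen_inv I G y = ereal r"
  shows "y \<le> G r"
proof (rule ccontr)
  assume "\<not> y \<le> G r"
  then obtain d where d: "d > 0" "\<And>v. v \<in> I \<Longrightarrow> r \<le> v \<Longrightarrow> dist v r < d \<Longrightarrow> dist (G v) (G r) < y - G r"
    using cont unfolding continuous_within_eps_delta
    by (metis IntI atLeast_iff diff_gt_0_iff_gt not_le)
  have "ereal (r + d) \<le> gen_inv I G y"
    unfolding gen_inv_def
  proof (rule INF_greatest)
    fix v assume v: "v \<in> {v \<in> I. y \<le> G v}"
    then have "ereal r \<le> ereal v" using r gen_inv_le[of v I y G] by simp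
    with v d(2)[of v] have "\<not> v < r + d"
      by (auto simp: dist_real_def)
    then show "ereal (r + d) \<le> ereal v" by simp
  qed
  with r d(1) show False by simp
qed

text \<open>The generalized inverse is monotone in the level, so at a level between two admissible
  ones its value is caught between two points of \<open>I\<close>. This makes \<open>inv_dom\<close>
  a legitimate domain for convex functions.\<close>

lemma convex_inv_dom:
  assumes I: "is_interval I" and J: "is_interval J"
  shows "convex (inv_dom I J G)"
proof -
  have "is_interval (inv_dom I J G)"
    unfolding is_interval_1
  proof (intro ballI allI impI)
    fix a b y
    assume a: "a \<in> inv_dom I J G" and b: "b \<in> inv_dom I J G" and y: "a \<le> y \<and> y \<le> b"
    obtain p q where p: "gen_inv I G a = ereal p" "p \<in> I" and q: "gen_inv I G b = ereal q" "q \<in> I"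
      using a b by (auto simp: inv_dom_def)
    have "ereal p \<le> gen_inv I G y" "gen_inv I G y \<le> ereal q"
      using y gen_inv_mono p q by metis+
    then obtain r where "gen_inv I G y = ereal r" "r \<in> I"
      using ereal_between_interval[OF I p(2) q(2)] by blast
    moreover have "y \<in> J" using a b y J by (auto simp: inv_dom_def intro: mem_is_interval_1_I)
    ultimately show "y \<in> inv_dom I J G" by (simp add: inv_dom_def)
  qed
  then show ?thesis by (simp add: is_interval_convex)
qed

section \<open>Greatest convex minorants and their left derivatives\<close>

lemma gcm_ge:
  assumes "convex_on D H" "\<And>s. s \<in> D \<Longrightarrow> H s \<le> G s" "t \<in> D"
  shows "H t \<le> gcm D G t"
  unfolding gcm_def using assms by (intro cSup_upper) (auto intro!: bdd_aboveI[of _ "G t"])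

text \<open>Boundedness of \<open>G\<close> supplies a constant convex minorant, so the supremum is
  over a nonempty set and every common upper bound \<open>b\<close> dominates it.\<close>

lemma gcm_least:
  assumes "convex D" "G \<in> bounded_funs D"
    and "\<And>H. convex_on D H \<Longrightarrow> \<forall>s\<in>D. H s \<le> G s \<Longrightarrow> H t \<le> b"
  shows "gcm D G t \<le> b"
proof -
  obtain B where B: "\<And>s. s \<in> D \<Longrightarrow> \<bar>G s\<bar> \<le> B"
    using assms(2) by (auto simp: bounded_funs_def bounded_iff)
  have "convex_on D (\<lambda>_. - B)" using assms(1) by (simp add: convex_on_const)
  moreover have "\<forall>s\<in>D. - B \<le> G s" using B by fastforce
  ultimately have "{H t | H. convex_on D H \<and> (\<forall>s\<in>D. H s \<le> G s)} \<noteq> {}" by blast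
  then show ?thesis unfolding gcm_def using assms(3) by (intro cSup_least) auto
qed

lemma gcm_le:
  assumes "convex D" "G \<in> bounded_funs D" "t \<in> D"
  shows "gcm D G t \<le> G t"
  using assms by (intro gcm_least) auto

lemma convex_on_gcm:
  assumes D: "convex D" and G: "G \<in> bounded_funs D"
  shows "convex_on D (gcm D G)"
proof (rule convex_onI)
  fix s x y :: real
  assume s: "0 < s" "s < 1" and x: "x \<in> D" and y: "y \<in> D"
  show "gcm D G ((1 - s) *\<^sub>R x + s *\<^sub>R y) \<le> (1 - s) * gcm D G x + s * gcm D G y"
  proof (rule gcm_least[OF D G])
    fix H assume H: "convex_on D H" "\<forall>s\<in>D. H s \<le> G s"
    have "H ((1 - s) *\<^sub>R x + s *\<^sub>R y) \<le> (1 - s) * H x + s * H y"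
      using convex_onD[OF H(1)] s x y by simp
    also have "\<dots> \<le> (1 - s) * gcm D G x + s * gcm D G y"
      using s x y gcm_ge[OF H(1)] H(2) by (intro add_mono mult_left_mono) auto
    finally show "H ((1 - s) *\<^sub>R x + s *\<^sub>R y) \<le> \<dots>" .
  qed
qed (rule D)

text \<open>The secant slopes \<open>q s\<close> increase as \<open>s\<close> approaches
  \<open>t\<close> from the left and are bounded by the secant slope to \<open>b\<close>. Hence they
  converge, the limit is the unique left derivative chosen by \<open>THE\<close>, and it inherits
  both bounds.\<close>

lemma left_deriv_convex_bounds:
  assumes f: "convex_on D f" and D: "a \<in> D" "b \<in> D" and t: "a < t" "t < b"
  shows "(f t - f a) / (t - a) \<le> left_deriv f t"
    and "left_deriv f t \<le> (f b - f t) / (b - t)"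
proof -
  define q where "q s = (f s - f t) / (s - t)" for s
  have conv: "is_interval D" using f by (simp add: convex_on_def is_interval_convex_1)
  have mem: "s \<in> D" if "a \<le> s" "s \<le> b" for s
    using conv D that by (meson mem_is_interval_1_I)
  have tD: "t \<in> D" using mem t by simp
  have mono: "q s \<le> q s'" if "a < s" "s \<le> s'" "s' < t" for s s'
  proof (cases "s = s'")
    case False
    then show ?thesis
      using convex_on_slope_le(2)[OF f mem[of s] tD, of s'] that t by (simp add: q_def)
  qed simp
  have upper: "q s \<le> (f b - f t) / (b - t)" if "a \<le> s" "s < t" for s
  proof -
    have "q s = (f s - f t) / (s - t)" by (simp add: q_def)
    also have "\<dots> \<le> (f s - f b) / (s - b)"
      using convex_on_slope_le(1)[OF f mem[of s] D(2), of t] that t by simp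
    also have "\<dots> \<le> (f t - f b) / (t - b)"
      using convex_on_slope_le(2)[OF f mem[of s] D(2), of t] that t by simp
    also have "\<dots> = (f b - f t) / (b - t)"
      by (metis minus_diff_eq minus_divide_divide)
    finally show ?thesis .
  qed
  \<comment> \<open>The limit of a bounded increasing function is its supremum; cutting down to
    points right of \<open>a\<close> leaves the filter \<open>at_left t\<close> unchanged.\<close>
  define d where "d = Sup (q ` ({..<t} \<inter> {a<..<t}))"
  have "(q \<longlongrightarrow> d) (at t within ({..<t} \<inter> {a<..<t}))"
    unfolding d_def by (rule Lim_left_bound[where K = "(f b - f t) / (b - t)"]) (auto intro: mono upper)
  moreover have "at t within ({..<t} \<inter> {a<..<t}) = at_left t"
    using t(1) by (intro at_within_nhd[where S = "{a<..}"]) auto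
  ultimately have lim: "(q \<longlongrightarrow> d) (at_left t)" by simp
  then have "(f has_real_derivative d) (at_left t)"
    by (simp add: has_field_derivative_iff q_def[abs_def])
  moreover have "d' = d" if "(f has_real_derivative d') (at_left t)" for d'
    using that lim tendsto_unique[of "at_left t" q d' d]
    by (simp add: has_field_derivative_iff q_def[abs_def])
  ultimately have d: "left_deriv f t = d"
    unfolding left_deriv_def by (rule the_equality)
  have ev: "eventually (\<lambda>s. a < s \<and> s < t) (at_left t)"
    using t(1) by (auto simp: eventually_at_left_field)
  show "left_deriv f t \<le> (f b - f t) / (b - t)"
    unfolding d
  proof (rule tendsto_upperbound[OF lim])
    show "eventually (\<lambda>s. q s \<le> (f b - f t) / (b - t)) (at_left t)"
      using ev by eventually_elim (simp add: upper)
  qed simp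
  have q_a: "q a \<le> q s" if "a < s" "s < t" for s
    using convex_on_slope_le(2)[OF f D(1) tD, of s] that by (simp add: q_def)
  have "eventually (\<lambda>s. q a \<le> q s) (at_left t)"
    using ev by eventually_elim (simp add: q_a)
  then have "q a \<le> d"
    using tendsto_lowerbound[OF lim] by simp
  moreover have "q a = (f t - f a) / (t - a)"
    unfolding q_def by (metis minus_diff_eq minus_divide_divide)
  ultimately show "(f t - f a) / (t - a) \<le> left_deriv f t" by (simp add: d)
qed

section \<open>Increments of the primitive\<close>

text \<open>The level \<open>y\<close> must lie strictly above \<open>\<Phi> w\<close>: at
  \<open>\<Phi> w\<close> itself the generalized inverse may lie to the left of \<open>w\<close>,
  even outside \<open>I\<close>.\<close>

lemma comp_inv_between:
  assumes I: "is_interval I" and \<theta>: "mono_on I \<theta>" and \<Phi>: "mono_on I \<Phi>"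
    and w: "w \<in> I" "z \<in> I" and y: "\<Phi> w < y" "y \<le> y'" "y' \<le> \<Phi> z"
  shows "\<theta> w \<le> comp_inv I \<theta> \<Phi> y" "comp_inv I \<theta> \<Phi> y \<le> comp_inv I \<theta> \<Phi> y'"
    "comp_inv I \<theta> \<Phi> y' \<le> \<theta> z"
proof -
  obtain r where r: "gen_inv I \<Phi> y = ereal r" "r \<in> I" "w \<le> r" "r \<le> z"
    using gen_inv_between[OF I \<Phi> w y(1)] y by (metis order.trans)
  obtain r' where r': "gen_inv I \<Phi> y' = ereal r'" "r' \<in> I" "w \<le> r'" "r' \<le> z"
    using gen_inv_between[OF I \<Phi> w _ y(3)] y by (metis order.strict_trans2)
  have "r \<le> r'" using gen_inv_mono[OF y(2), of I \<Phi>] r r' by simp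
  with r r' w \<theta> show "\<theta> w \<le> comp_inv I \<theta> \<Phi> y" "comp_inv I \<theta> \<Phi> y \<le> comp_inv I \<theta> \<Phi> y'"
    "comp_inv I \<theta> \<Phi> y' \<le> \<theta> z"
    by (auto simp: comp_inv_def mono_on_def)
qed

text \<open>Up to the infimum \<open>L\<close> of \<open>\<Phi>\<close> on \<open>I\<close> the
  composite is constant, since every point of \<open>I\<close> reaches such levels; above
  \<open>L\<close> it is monotone. Both pieces are integrable.\<close>

lemma comp_inv_integrable:
  assumes I: "is_interval I" and \<theta>: "mono_on I \<theta>" "bounded (\<theta> ` I)"
    and \<Phi>: "mono_on I \<Phi>" "\<Phi> ` I \<subseteq> {0..}" and z: "z \<in> I"
  shows "comp_inv I \<theta> \<Phi> integrable_on {0..\<Phi> z}"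
proof -
  define L where "L = Inf (\<Phi> ` I)"
  have bdd: "bdd_below (\<Phi> ` I)" using \<Phi>(2) by (meson bdd_below.I2 bdd_below_mono bdd_below_Ici)
  have L: "0 \<le> L" "L \<le> \<Phi> z"
    unfolding L_def using \<Phi>(2) z bdd by (auto intro!: cINF_greatest cINF_lower)
  obtain B where B: "\<And>x. x \<in> I \<Longrightarrow> \<bar>\<theta> x\<bar> \<le> B"
    using \<theta>(2) by (auto simp: bounded_iff)
  have above: "\<exists>w\<in>I. \<Phi> w < y" if "L < y" for y
    using cINF_less_iff[OF _ bdd, of y] z that by (auto simp: L_def)
  have const: "comp_inv I \<theta> \<Phi> y = comp_inv I \<theta> \<Phi> L" if "y \<le> L" for y
  proof -
    have "L \<le> \<Phi> v" if "v \<in> I" for v unfolding L_def using that bdd by (rule cINF_lower[rotated])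
    with that have "{v\<in>I. y \<le> \<Phi> v} = {v\<in>I. L \<le> \<Phi> v}" by force
    then show ?thesis by (simp add: comp_inv_def gen_inv_def)
  qed
  have "(\<lambda>_. comp_inv I \<theta> \<Phi> L) integrable_on {0..L}" by (rule integrable_const_ivl)
  then have 1: "comp_inv I \<theta> \<Phi> integrable_on {0..L}"
    by (rule integrable_eq) (metis atLeastAtMost_iff const)
  \<comment> \<open>At \<open>L\<close> the generalized inverse may leave \<open>I\<close>, so the
    value there is uncontrolled. Replacing it by the lower bound \<open>- B\<close> restores
    monotonicity at the cost of one point.\<close>
  define p where "p y = (if y \<le> L then - B else comp_inv I \<theta> \<Phi> y)" for y
  have "mono_on {L..\<Phi> z} p"
  proof (rule mono_onI)
    fix y y' assume y: "y \<in> {L..\<Phi> z}" "y' \<in> {L..\<Phi> z}" "y \<le> y'"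
    show "p y \<le> p y'"
    proof (cases "y' \<le> L")
      case False
      show ?thesis
      proof (cases "y \<le> L")
        case True
        obtain w where w: "w \<in> I" "\<Phi> w < y'" using above[of y'] False by auto
        have "- B \<le> \<theta> w" using B[OF w(1)] by linarith
        also have "\<theta> w \<le> comp_inv I \<theta> \<Phi> y'"
          using comp_inv_between(1)[OF I \<theta>(1) \<Phi>(1) w(1) z w(2), of y'] y by auto
        finally show ?thesis using True False by (simp add: p_def)
      next
        case yL: False
        then obtain w where w: "w \<in> I" "\<Phi> w < y" using above[of y] by auto
        show ?thesis
          using comp_inv_between(2)[OF I \<theta>(1) \<Phi>(1) w(1) z w(2) y(3)] y False yL by (simp add: p_def)
      qed
    qed (use y in \<open>simp add: p_def\<close>)
  qed
  then have "p integrable_on {L..\<Phi> z}" by (rule integrable_on_mono_on)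
  then have "comp_inv I \<theta> \<Phi> integrable_on {L..\<Phi> z}"
    by (rule integrable_spike_finite[of "{L}", rotated 2]) (auto simp: p_def)
  with 1 L show ?thesis by (rule_tac Henstock_Kurzweil_Integration.integrable_combine[of 0 L])
qed

text \<open>The increment is the integral of the composite over \<open>[\<Phi> w, \<Phi> z]\<close>,
  where the integrand lies between \<open>\<theta> w\<close> and \<open>\<theta> z\<close> except
  possibly at the left endpoint.\<close>

lemma primitive_fun_increment:
  assumes I: "is_interval I" and \<theta>: "mono_on I \<theta>" "bounded (\<theta> ` I)"
    and \<Phi>: "mono_on I \<Phi>" "\<Phi> ` I \<subseteq> {0..}" and w: "w \<in> I" "z \<in> I" "w \<le> z"
  shows "\<theta> w * (\<Phi> z - \<Phi> w) \<le> primitive_fun I \<theta> \<Phi> (\<Phi> z) - primitive_fun I \<theta> \<Phi> (\<Phi> w)" (is ?lower)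
    and "primitive_fun I \<theta> \<Phi> (\<Phi> z) - primitive_fun I \<theta> \<Phi> (\<Phi> w) \<le> \<theta> z * (\<Phi> z - \<Phi> w)" (is ?upper)
proof -
  let ?p = "comp_inv I \<theta> \<Phi>"
  have le: "\<Phi> w \<le> \<Phi> z" "0 \<le> \<Phi> w" using \<Phi> w by (auto simp: mono_on_def)
  have int: "?p integrable_on {0..\<Phi> z}" by (rule comp_inv_integrable[OF I \<theta> \<Phi> w(2)])
  have eq: "primitive_fun I \<theta> \<Phi> (\<Phi> z) - primitive_fun I \<theta> \<Phi> (\<Phi> w) = integral {\<Phi> w..\<Phi> z} ?p"
    using Henstock_Kurzweil_Integration.integral_combine[OF le(2,1) int] by (simp add: primitive_fun_def)
  have int': "(?p has_integral integral {\<Phi> w..\<Phi> z} ?p) {\<Phi> w..\<Phi> z}"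
    using integrable_subinterval_real[OF int, of "\<Phi> w" "\<Phi> z"] le by auto
  \<comment> \<open>The comparison functions copy the integrand at \<open>\<Phi> w\<close>, so that
    the pointwise inequality holds on the whole closed interval.\<close>
  have lo: "((\<lambda>y. if y = \<Phi> w then ?p y else \<theta> w) has_integral \<theta> w * (\<Phi> z - \<Phi> w)) {\<Phi> w..\<Phi> z}"
    using has_integral_const_real[of "\<theta> w" "\<Phi> w" "\<Phi> z"] le
    by (rule_tac has_integral_spike_finite[where S = "{\<Phi> w}" and f = "\<lambda>_. \<theta> w"]) (auto simp: mult.commute)
  have hi: "((\<lambda>y. if y = \<Phi> w then ?p y else \<theta> z) has_integral \<theta> z * (\<Phi> z - \<Phi> w)) {\<Phi> w..\<Phi> z}"
    using has_integral_const_real[of "\<theta> z" "\<Phi> w" "\<Phi> z"] le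
    by (rule_tac has_integral_spike_finite[where S = "{\<Phi> w}" and f = "\<lambda>_. \<theta> z"]) (auto simp: mult.commute)
  show ?lower unfolding eq
    by (rule has_integral_le[OF lo int']) (use comp_inv_between(1)[OF I \<theta>(1) \<Phi>(1) w(1,2)] in auto)
  show ?upper unfolding eq
    by (rule has_integral_le[OF int' hi]) (use comp_inv_between(3)[OF I \<theta>(1) \<Phi>(1) w(1,2) _ order_refl] in auto)
qed

section \<open>Deterministic error bound\<close>

text \<open>The extra point \<open>a'\<close> puts the level \<open>\<Phi> a\<close> strictly above
  another value of \<open>\<Phi>\<close>, which keeps its generalized inverse in
  \<open>[a', a]\<close>. Assumption \<open>alt\<close> covers negative slopes, for which an
  overshoot of \<open>\<Phi>\<close> composed with its inverse would lift the tangent line. The last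
  bound on \<open>\<eta>\<close> pays for the total error in the numerators of the secant
  slopes.\<close>

lemma grenander_error:
  assumes I: "is_interval I"
    and \<theta>0: "mono_on I \<theta>\<^sub>0" and \<Phi>0: "mono_on I \<Phi>\<^sub>0"
    and inc: "\<And>w z. w \<in> I \<Longrightarrow> z \<in> I \<Longrightarrow> w \<le> z \<Longrightarrow>
      \<theta>\<^sub>0 w * (\<Phi>\<^sub>0 z - \<Phi>\<^sub>0 w) \<le> \<Gamma>\<^sub>0 z - \<Gamma>\<^sub>0 w \<and> \<Gamma>\<^sub>0 z - \<Gamma>\<^sub>0 w \<le> \<theta>\<^sub>0 z * (\<Phi>\<^sub>0 z - \<Phi>\<^sub>0 w)"
    and \<Phi>: "\<Phi> \<in> cadlag_mono_into I {0..u}"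
    and bdd: "comp_inv I \<Gamma> \<Phi> \<in> bounded_funs (inv_dom I {0..u} \<Phi>)"
    and pts: "a' < a" "a < x" "x < b" "a' \<in> I" "b \<in> I"
    and osc: "\<theta>\<^sub>0 x - \<epsilon> \<le> \<theta>\<^sub>0 a'" "\<theta>\<^sub>0 b \<le> \<theta>\<^sub>0 x + \<epsilon>" and C: "\<bar>\<theta>\<^sub>0 x\<bar> \<le> C"
    and gap: "\<kappa> \<le> \<Phi>\<^sub>0 a - \<Phi>\<^sub>0 a'" "\<kappa> \<le> \<Phi>\<^sub>0 x - \<Phi>\<^sub>0 a" "\<kappa> \<le> \<Phi>\<^sub>0 b - \<Phi>\<^sub>0 x"
    and \<Gamma>: "\<And>z. z \<in> inv_range I {0..u} \<Phi> \<Longrightarrow> \<bar>\<Gamma> z - \<Gamma>\<^sub>0 z\<bar> \<le> \<eta>"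
    and \<Phi>_inv: "\<And>z. z \<in> inv_range I {0..u} \<Phi> \<Longrightarrow> \<bar>\<Phi> z - \<Phi>\<^sub>0 z\<bar> \<le> \<eta>"
    and \<Phi>_loc: "\<And>z. z \<in> {a'..b} \<Longrightarrow> \<bar>\<Phi> z - \<Phi>\<^sub>0 z\<bar> \<le> \<eta>"
    and alt: "0 \<le> \<theta>\<^sub>0 x \<or> (\<forall>s\<in>inv_dom I {0..u} \<Phi>. comp_inv I \<Phi> \<Phi> s \<le> s + 2 * \<eta>)"
    and \<epsilon>: "0 < \<epsilon>" and \<kappa>: "0 < \<kappa>"
    and \<eta>: "0 \<le> \<eta>" "4 * \<eta> \<le> \<kappa>" "(12 * C + 4 + 4 * \<epsilon>) * \<eta> \<le> \<kappa> * \<epsilon>"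
  shows "\<bar>grenander I {0..u} \<Gamma> \<Phi> x - \<theta>\<^sub>0 x\<bar> \<le> 2 * \<epsilon>"
proof -
  define D where "D = inv_dom I {0..u} \<Phi>"
  define \<Psi> where "\<Psi> = comp_inv I \<Gamma> \<Phi>"
  define H where "H = gcm D \<Psi>"
  define c where "c = \<theta>\<^sub>0 x"
  define t where "t = \<Phi> x"
  have C0: "0 \<le> C" using C by linarith
  have mono: "mono_on I \<Phi>" and range: "\<And>v. v \<in> I \<Longrightarrow> \<Phi> v \<in> {0..u}"
    and cont: "\<And>v. v \<in> I \<Longrightarrow> continuous (at v within (I \<inter> {v..})) \<Phi>"
    using \<Phi> by (auto simp: cadlag_mono_into_def cadlag_mono_def)
  have mem: "v \<in> I" if "a' \<le> v" "v \<le> b" for v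
    using I pts that by (meson mem_is_interval_1_I)
  have xI: "x \<in> I" and aI: "a \<in> I" using mem pts by auto
  have convD: "convex D" unfolding D_def by (rule convex_inv_dom[OF I is_interval_cc])
  have bdd': "\<Psi> \<in> bounded_funs D" using bdd by (simp add: \<Psi>_def D_def)
  have convH: "convex_on D H" unfolding H_def by (rule convex_on_gcm[OF convD bdd'])
  \<comment> \<open>Monotonicity of \<open>\<theta>\<^sub>0\<close>, through \<open>inc\<close> on
    either side of \<open>x\<close>, makes this a supporting line in the variable
    \<open>\<Phi>\<^sub>0 z\<close>.\<close>
  have tangent: "\<Gamma>\<^sub>0 x + c * (\<Phi>\<^sub>0 z - \<Phi>\<^sub>0 x) \<le> \<Gamma>\<^sub>0 z" if "z \<in> I" for z
    using inc[OF xI that] inc[OF that xI] unfolding c_def by (cases "x \<le> z") (auto simp: algebra_simps)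
  have scale: "\<bar>c * v\<bar> \<le> C * w" if "\<bar>v\<bar> \<le> w" for v w
    using C that C0 by (auto simp: c_def abs_mult intro: mult_mono)
  \<comment> \<open>Exchanging \<open>\<Phi>\<^sub>0 z\<close> for the level \<open>s\<close> costs
    at most \<open>3 * C * \<eta>\<close>, and exchanging \<open>\<Gamma>\<^sub>0\<close> for
    \<open>\<Gamma>\<close> costs \<open>\<eta>\<close>.\<close>
  have minor: "\<Gamma>\<^sub>0 x + c * (s - \<Phi>\<^sub>0 x) - (3 * C + 1) * \<eta> \<le> \<Psi> s" if s: "s \<in> D" for s
  proof -
    obtain z where z: "gen_inv I \<Phi> s = ereal z" "z \<in> I" using s by (auto simp: D_def inv_dom_def)
    then have zR: "z \<in> inv_range I {0..u} \<Phi>"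
      using s by (auto simp: inv_range_def D_def inv_dom_def intro!: bexI[of _ s])
    have s_le: "s \<le> \<Phi> z" by (rule le_at_gen_inv[OF cont[OF z(2)] z(1)])
    have "c * (s - \<Phi>\<^sub>0 z) \<le> 3 * C * \<eta>"
      using alt
    proof
      assume "0 \<le> \<theta>\<^sub>0 x"
      then have "c * (s - \<Phi>\<^sub>0 z) \<le> c * \<eta>"
        using s_le \<Phi>_inv[OF zR] by (intro mult_left_mono) (auto simp: c_def)
      also have "\<dots> \<le> C * \<eta>" using scale[of \<eta> \<eta>] \<eta>(1) by auto
      finally show ?thesis using mult_nonneg_nonneg[OF C0 \<eta>(1)] by linarith
    next
      assume "\<forall>s\<in>inv_dom I {0..u} \<Phi>. comp_inv I \<Phi> \<Phi> s \<le> s + 2 * \<eta>"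
      then have "\<Phi> z \<le> s + 2 * \<eta>" using s z by (auto simp: D_def comp_inv_def)
      then have "\<bar>s - \<Phi>\<^sub>0 z\<bar> \<le> 3 * \<eta>" using s_le \<Phi>_inv[OF zR] \<eta>(1) by linarith
      from scale[OF this] show ?thesis by linarith
    qed
    moreover have "\<Psi> s = \<Gamma> z" by (simp add: \<Psi>_def comp_inv_def z)
    ultimately show ?thesis
      using tangent[OF z(2)] \<Gamma>[OF zR] by (simp add: algebra_simps)
  qed
  \<comment> \<open>At a level \<open>\<Phi> v\<close> that is a value of \<open>\<Phi>\<close>,
    right-continuity and monotonicity force \<open>\<Phi> z = \<Phi> v\<close> at the generalized
    inverse \<open>z\<close>. The point \<open>w\<close> ensures that \<open>z\<close> lies in
    \<open>I\<close> and not left of \<open>w\<close>.\<close>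
  have reach: "\<exists>z\<in>I. w \<le> z \<and> z \<le> v \<and> \<Phi> z = \<Phi> v \<and> \<Phi> v \<in> D \<and> \<Psi> (\<Phi> v) \<le> \<Gamma>\<^sub>0 z + \<eta>"
    if wv: "w \<in> I" "v \<in> I" "\<Phi> w < \<Phi> v" for w v
  proof -
    obtain z where z: "gen_inv I \<Phi> (\<Phi> v) = ereal z" "z \<in> I" "w \<le> z" "z \<le> v"
      using gen_inv_between[OF I mono wv order_refl] by blast
    have "\<Phi> v \<le> \<Phi> z" by (rule le_at_gen_inv[OF cont[OF z(2)] z(1)])
    moreover have "\<Phi> z \<le> \<Phi> v" using mono z wv by (auto simp: mono_on_def)
    moreover have "\<Phi> v \<in> D" using z range[OF wv(2)] by (auto simp: D_def inv_dom_def)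
    moreover have "z \<in> inv_range I {0..u} \<Phi>"
      using z(1,2) range[OF wv(2)] by (auto simp: inv_range_def intro!: bexI[of _ "\<Phi> v"])
    from \<Gamma>[OF this] have "\<Psi> (\<Phi> v) \<le> \<Gamma>\<^sub>0 z + \<eta>" by (simp add: \<Psi>_def comp_inv_def z)
    ultimately show ?thesis using z by force
  qed
  have loc: "\<bar>\<Phi> a' - \<Phi>\<^sub>0 a'\<bar> \<le> \<eta>" "\<bar>\<Phi> a - \<Phi>\<^sub>0 a\<bar> \<le> \<eta>" "\<bar>t - \<Phi>\<^sub>0 x\<bar> \<le> \<eta>" "\<bar>\<Phi> b - \<Phi>\<^sub>0 b\<bar> \<le> \<eta>"
    unfolding t_def using pts by (auto intro!: \<Phi>_loc)
  \<comment> \<open>Passing from \<open>\<Phi>\<^sub>0\<close> to \<open>\<Phi>\<close> loses at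
    most \<open>2 * \<eta>\<close>, which is at most half of \<open>\<kappa>\<close>.\<close>
  have steps: "\<Phi> a' < \<Phi> a" "\<kappa> / 2 \<le> t - \<Phi> a" "\<kappa> / 2 \<le> \<Phi> b - t"
    using loc gap \<eta>(2) \<kappa> by linarith+
  then have "\<Phi> x < \<Phi> b" using \<kappa> t_def by linarith
  obtain za where za: "a' \<le> za" "za \<le> a" "\<Phi> za = \<Phi> a" "\<Phi> a \<in> D" "\<Psi> (\<Phi> a) \<le> \<Gamma>\<^sub>0 za + \<eta>" "za \<in> I"
    using reach[OF pts(4) aI steps(1)] by blast
  obtain zb where zb: "x \<le> zb" "zb \<le> b" "\<Phi> zb = \<Phi> b" "\<Phi> b \<in> D" "\<Psi> (\<Phi> b) \<le> \<Gamma>\<^sub>0 zb + \<eta>" "zb \<in> I"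
    using reach[OF xI pts(5) \<open>\<Phi> x < \<Phi> b\<close>] by blast
  have tD: "t \<in> D"
    using convD za(4) zb(4) steps \<kappa> by (smt (verit) is_interval_convex_1 mem_is_interval_1_I half_gt_zero)
  have affine: "convex_on D (\<lambda>s. \<Gamma>\<^sub>0 x + c * (s - \<Phi>\<^sub>0 x) - (3 * C + 1) * \<eta>)"
  proof (rule convex_onI)
    fix r p q :: real
    have "\<Gamma>\<^sub>0 x + c * (((1 - r) *\<^sub>R p + r *\<^sub>R q) - \<Phi>\<^sub>0 x) - (3 * C + 1) * \<eta>
        = (1 - r) * (\<Gamma>\<^sub>0 x + c * (p - \<Phi>\<^sub>0 x) - (3 * C + 1) * \<eta>)
          + r * (\<Gamma>\<^sub>0 x + c * (q - \<Phi>\<^sub>0 x) - (3 * C + 1) * \<eta>)"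
      by (simp add: algebra_simps)
    then show "\<Gamma>\<^sub>0 x + c * (((1 - r) *\<^sub>R p + r *\<^sub>R q) - \<Phi>\<^sub>0 x) - (3 * C + 1) * \<eta>
        \<le> (1 - r) * (\<Gamma>\<^sub>0 x + c * (p - \<Phi>\<^sub>0 x) - (3 * C + 1) * \<eta>)
          + r * (\<Gamma>\<^sub>0 x + c * (q - \<Phi>\<^sub>0 x) - (3 * C + 1) * \<eta>)"
      by (rule eq_refl)
  qed (rule convD)
  \<comment> \<open>The fourth \<open>C * \<eta>\<close> comes from evaluating the line at
    \<open>t\<close> instead of \<open>\<Phi>\<^sub>0 x\<close>.\<close>
  have Ht: "\<Gamma>\<^sub>0 x - (4 * C + 1) * \<eta> \<le> H t"
    using gcm_ge[OF affine minor tD] scale[OF loc(3)] unfolding H_def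
    by (simp add: algebra_simps)
  \<comment> \<open>The coefficient is the sum of \<open>4 * C + 2\<close>, the error in the values,
    and \<open>2 * C + 2 * \<epsilon>\<close>, the error from exchanging increments of
    \<open>\<Phi>\<^sub>0\<close> for increments of \<open>\<Phi>\<close>. The sum is absorbed by a
    second \<open>\<epsilon>\<close> in the slope.\<close>
  have slack: "(6 * C + 2 + 2 * \<epsilon>) * \<eta> \<le> \<epsilon> * l" if "\<kappa> / 2 \<le> l" for l
  proof -
    have "(6 * C + 2 + 2 * \<epsilon>) * \<eta> \<le> \<epsilon> * (\<kappa> / 2)" using \<eta>(3) by (simp add: algebra_simps)
    also have "\<dots> \<le> \<epsilon> * l" using that \<epsilon> by (intro mult_left_mono) auto
    finally show ?thesis .
  qed
  have upper: "(H (\<Phi> b) - H t) / (\<Phi> b - t) \<le> c + 2 * \<epsilon>"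
  proof -
    \<comment> \<open>\<open>\<Gamma>\<^sub>0\<close> is controlled by the increment
      \<open>p\<close>, whereas the secant slope divides by \<open>l\<close>. They differ by at most
      \<open>2 * \<eta>\<close> because \<open>\<Phi> zb = \<Phi> b\<close> and \<open>zb\<close>
      lies in the range where \<open>\<Phi>\<close> is close to
      \<open>\<Phi>\<^sub>0\<close>.\<close>
    define p where "p = \<Phi>\<^sub>0 zb - \<Phi>\<^sub>0 x"
    define l where "l = \<Phi> b - t"
    have p: "0 \<le> p" "\<bar>p - l\<bar> \<le> 2 * \<eta>"
      using \<Phi>0 xI zb(1,6) \<Phi>_loc[of zb] zb(1-3) pts loc(3)
      by (auto simp: p_def l_def mono_on_def)
    have "H (\<Phi> b) \<le> \<Gamma>\<^sub>0 zb + \<eta>"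
      using gcm_le[OF convD bdd' zb(4)] zb(5) by (simp add: H_def)
    also have "\<Gamma>\<^sub>0 zb \<le> \<Gamma>\<^sub>0 x + \<theta>\<^sub>0 zb * p"
      using inc[OF xI zb(6,1)] by (simp add: p_def)
    also have "\<theta>\<^sub>0 zb * p \<le> (c + \<epsilon>) * p"
      using \<theta>0 zb pts(5) osc(2) p(1)
      by (intro mult_right_mono) (auto simp: c_def mono_on_def intro: order_trans)
    finally have "H (\<Phi> b) - H t \<le> (c + \<epsilon>) * p + (4 * C + 2) * \<eta>"
      using Ht by (simp add: algebra_simps)
    also have "(c + \<epsilon>) * p \<le> (c + \<epsilon>) * l + (2 * C + 2 * \<epsilon>) * \<eta>"
    proof -
      have "\<epsilon> * (p - l) \<le> \<epsilon> * (2 * \<eta>)" using p(2) \<epsilon> by (intro mult_left_mono) auto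
      then show ?thesis using scale[OF p(2)] by (simp add: algebra_simps)
    qed
    finally have "H (\<Phi> b) - H t \<le> (c + 2 * \<epsilon>) * l"
      using slack[of l] steps(3) by (simp add: l_def algebra_simps)
    then show ?thesis using steps(3) \<kappa> by (simp add: l_def pos_divide_le_eq)
  qed
  have lower: "c - 2 * \<epsilon> \<le> (H t - H (\<Phi> a)) / (t - \<Phi> a)"
  proof -
    define p where "p = \<Phi>\<^sub>0 x - \<Phi>\<^sub>0 za"
    define l where "l = t - \<Phi> a"
    have zax: "za \<le> x" using za(2) pts(2) by simp
    have p: "0 \<le> p" "\<bar>p - l\<bar> \<le> 2 * \<eta>"
      using \<Phi>0 xI za(6) zax \<Phi>_loc[of za] za(1-3) pts loc(3)
      by (auto simp: p_def l_def mono_on_def)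
    have "(c - \<epsilon>) * p \<le> \<theta>\<^sub>0 za * p"
      using \<theta>0 za pts(4) osc(1) p(1)
      by (intro mult_right_mono) (auto simp: c_def mono_on_def intro: order_trans)
    also have "\<dots> \<le> \<Gamma>\<^sub>0 x - \<Gamma>\<^sub>0 za"
      using inc[OF za(6) xI zax] by (simp add: p_def)
    finally have "(c - \<epsilon>) * p \<le> \<Gamma>\<^sub>0 x - H (\<Phi> a) + \<eta>"
      using gcm_le[OF convD bdd' za(4)] za(5) by (simp add: H_def)
    then have "(c - \<epsilon>) * p - (4 * C + 2) * \<eta> \<le> H t - H (\<Phi> a)"
      using Ht by (simp add: algebra_simps)
    moreover have "(c - \<epsilon>) * l - (2 * C + 2 * \<epsilon>) * \<eta> \<le> (c - \<epsilon>) * p"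
    proof -
      have "\<epsilon> * (p - l) \<le> \<epsilon> * (2 * \<eta>)" using p(2) \<epsilon> by (intro mult_left_mono) auto
      then show ?thesis using scale[OF p(2)] by (simp add: algebra_simps)
    qed
    ultimately have "(c - 2 * \<epsilon>) * l \<le> H t - H (\<Phi> a)"
      using slack[of l] steps(2) by (simp add: l_def algebra_simps)
    then show ?thesis using steps(2) \<kappa> by (simp add: l_def pos_le_divide_eq)
  qed
  have "\<Phi> a < t" "t < \<Phi> b" using steps \<kappa> by linarith+
  from left_deriv_convex_bounds[OF convH za(4) zb(4) this] upper lower
  have "\<bar>left_deriv H t - c\<bar> \<le> 2 * \<epsilon>" by linarith
  then show ?thesis
    by (simp add: grenander_def Iso_def H_def \<Psi>_def D_def t_def c_def)
qed

text \<open>Just left of the generalized inverse \<open>z\<close>, \<open>\<Phi>\<close> is below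
  \<open>s\<close>. Since \<open>\<Phi>\<^sub>0\<close> is continuous and
  \<open>\<eta>\<close>-close, \<open>\<Phi>\<close> can jump by at most \<open>2 * \<eta>\<close>
  at \<open>z\<close>. If \<open>z\<close> is the least point of \<open>I\<close>, nothing lies to
  its left, and \<open>\<Phi>\<^sub>0 z = 0\<close> takes over.\<close>

lemma comp_inv_self_le:
  assumes I: "is_interval I" and cont: "continuous_on I \<Phi>\<^sub>0"
    and close: "\<And>z. z \<in> I \<Longrightarrow> \<bar>\<Phi> z - \<Phi>\<^sub>0 z\<bar> \<le> \<eta>"
    and left: "\<forall>a\<in>I. (\<forall>y\<in>I. a \<le> y) \<longrightarrow> \<Phi>\<^sub>0 a = 0"
    and s: "s \<in> inv_dom I {0..u} \<Phi>"
  shows "comp_inv I \<Phi> \<Phi> s \<le> s + 2 * \<eta>"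
proof -
  obtain z where z: "gen_inv I \<Phi> s = ereal z" "z \<in> I" and s0: "0 \<le> s"
    using s by (auto simp: inv_dom_def)
  have "\<Phi> z \<le> s + 2 * \<eta>"
  proof (cases "\<forall>y\<in>I. z \<le> y")
    case True
    then have "\<Phi>\<^sub>0 z = 0" using left z(2) by blast
    then show ?thesis using close[OF z(2)] s0 by linarith
  next
    case False
    then obtain y where y: "y \<in> I" "y < z" by auto
    show ?thesis
    proof (rule ccontr)
      assume "\<not> ?thesis"
      then have "0 < \<Phi> z - s - 2 * \<eta>" by simp
      then obtain d where d: "d > 0" "\<And>v. v \<in> I \<Longrightarrow> dist v z < d \<Longrightarrow> dist (\<Phi>\<^sub>0 v) (\<Phi>\<^sub>0 z) < \<Phi> z - s - 2 * \<eta>"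
        using cont z(2) unfolding continuous_on_iff by metis
      \<comment> \<open>The maximum with \<open>y\<close> keeps the nearby point inside
        \<open>I\<close>.\<close>
      define v where "v = max y (z - d / 2)"
      have v: "v < z" "v \<in> I" "dist v z < d"
        using y d(1) I z(2) by (auto simp: v_def dist_real_def intro: mem_is_interval_1_I[of I y z])
      have "\<Phi> v < s"
        using gen_inv_le[of v I s \<Phi>] v z by force
      with d(2)[OF v(2,3)] close[OF v(2)] close[OF z(2)] show False
        unfolding dist_real_def by linarith
    qed
  qed
  then show ?thesis by (simp add: comp_inv_def z)
qed

text \<open>Every interval of length \<open>r\<close> contains a cell of the grid of mesh \<open>r / 2\<close>, and only finitely
  many cells meet \<open>I\<close>; this makes the increments of \<open>f\<close> uniformly positive without continuity.\<close>

lemma strict_mono_on_uniform_gap: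
  fixes f :: "real \<Rightarrow> real"
  assumes I: "is_interval I" "bounded I" and f: "strict_mono_on I f" and r: "0 < r"
  obtains \<kappa> where "0 < \<kappa>" "\<And>x. x \<in> I \<Longrightarrow> x + r \<in> I \<Longrightarrow> \<kappa> \<le> f (x + r) - f x"
proof -
  define h where "h = r / 2"
  have h: "0 < h" using r by (simp add: h_def)
  obtain B where B: "\<And>x. x \<in> I \<Longrightarrow> \<bar>x\<bar> \<le> B" using I(2) by (auto simp: bounded_iff)
  define K where "K = {k::int. of_int k * h \<in> I \<and> of_int (k + 1) * h \<in> I}"
  have "K \<subseteq> {-\<lceil>B / h\<rceil>..\<lceil>B / h\<rceil>}"
  proof
    fix k assume "k \<in> K"
    then have "\<bar>of_int k * h\<bar> \<le> B" by (auto simp: K_def intro: B)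
    then have "\<bar>of_int k\<bar> \<le> B / h" using h by (simp add: abs_mult pos_le_divide_eq)
    then have "\<bar>of_int k\<bar> \<le> (of_int \<lceil>B / h\<rceil> :: real)" by linarith
    then show "k \<in> {-\<lceil>B / h\<rceil>..\<lceil>B / h\<rceil>}" by (simp add: abs_le_iff)
  qed
  then have K: "finite K" by (rule finite_subset) simp
  \<comment> \<open>The inserted \<open>1\<close> is a default that keeps the minimum meaningful
    when no grid cell lies in \<open>I\<close>.\<close>
  define S where "S = insert 1 ((\<lambda>k. f (of_int (k + 1) * h) - f (of_int k * h)) ` K)"
  have S: "finite S" "S \<noteq> {}" using K by (auto simp: S_def)
  show thesis
  proof
    have "\<forall>s\<in>S. 0 < s"
      using h f by (auto simp: S_def K_def strict_mono_on_def algebra_simps)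
    then show "0 < Min S" using S by simp
    fix x assume x: "x \<in> I" "x + r \<in> I"
    \<comment> \<open>\<open>k * h\<close> is the first grid point not left of \<open>x\<close>,
      hence less than \<open>x + h\<close>; the next one is still below
      \<open>x + 2 * h = x + r\<close>.\<close>
    define k where "k = \<lceil>x / h\<rceil>"
    have "x / h \<le> of_int k" "of_int k < x / h + 1" unfolding k_def by linarith+
    then have k: "x \<le> of_int k * h" "of_int (k + 1) * h < x + r"
      using h by (auto simp: pos_divide_le_eq field_simps h_def)
    have step: "of_int k * h < of_int (k + 1) * h" using h by (simp add: algebra_simps)
    then have mem: "of_int k * h \<in> I" "of_int (k + 1) * h \<in> I"
      using k by (auto intro!: mem_is_interval_1_I[OF I(1) x] simp del: of_int_add)
    then have "Min S \<le> f (of_int (k + 1) * h) - f (of_int k * h)"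
      using S by (intro Min_le) (auto simp: S_def K_def)
    also have "\<dots> \<le> f (x + r) - f x"
      using strict_mono_onD[OF f] x mem k by (intro diff_mono) (auto simp: le_less simp del: of_int_add)
    finally show "Min S \<le> f (x + r) - f x" .
  qed
qed

section \<open>Convergence in outer probability\<close>

text \<open>Each set has a measurable cover of the same outer measure, which reduces the claim to
  subadditivity of the measure.\<close>

lemma outer_measure_of_Un_le:
  assumes "A \<subseteq> space M" "B \<subseteq> space M"
  shows "outer_measure_of M (A \<union> B) \<le> outer_measure_of M A + outer_measure_of M B"
proof -
  obtain E where E: "E \<in> sets M" "A \<subseteq> E" "outer_measure_of M A = emeasure M E"
    using outer_measure_of_attain[OF assms(1)] by blast
  obtain F where F: "F \<in> sets M" "B \<subseteq> F" "outer_measure_of M B = emeasure M F"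
    using outer_measure_of_attain[OF assms(2)] by blast
  have "outer_measure_of M (A \<union> B) \<le> outer_measure_of M (E \<union> F)"
    using E F by (intro outer_measure_of_mono) auto
  also have "\<dots> \<le> emeasure M E + emeasure M F"
    using E F by (simp add: emeasure_subadditive)
  finally show ?thesis by (simp add: E F)
qed

lemma null_in_prob_max:
  assumes X: "null_in_prob M X" and Y: "null_in_prob M Y"
  shows "null_in_prob M (\<lambda>n \<omega>. max (X n \<omega>) (Y n \<omega>))"
  unfolding null_in_prob_def
proof (intro allI impI)
  fix \<epsilon> :: real assume "0 < \<epsilon>"
  let ?m = "\<lambda>Z n. outer_measure_of (M n) {\<omega>\<in>space (M n). ennreal \<epsilon> < Z n \<omega>}"
  have "(\<lambda>n. ?m X n + ?m Y n) \<longlonglongrightarrow> 0 + 0"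
    using X Y \<open>0 < \<epsilon>\<close> unfolding null_in_prob_def by (intro tendsto_add) auto
  moreover have "?m (\<lambda>n \<omega>. max (X n \<omega>) (Y n \<omega>)) n \<le> ?m X n + ?m Y n" for n
  proof -
    have "{\<omega>\<in>space (M n). ennreal \<epsilon> < max (X n \<omega>) (Y n \<omega>)}
        = {\<omega>\<in>space (M n). ennreal \<epsilon> < X n \<omega>} \<union> {\<omega>\<in>space (M n). ennreal \<epsilon> < Y n \<omega>}"
      by (auto simp: less_max_iff_disj)
    then show ?thesis by (simp add: outer_measure_of_Un_le)
  qed
  ultimately show "?m (\<lambda>n \<omega>. max (X n \<omega>) (Y n \<omega>)) \<longlonglongrightarrow> 0"
    by (rule_tac tendsto_sandwich[where f = "\<lambda>_. 0" and h = "\<lambda>n. ?m X n + ?m Y n"]) auto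
qed

text \<open>The bridge from deterministic estimates to probability: since \<open>\<eta>\<close>
  depends on neither \<open>n\<close> nor \<open>\<omega>\<close>, the bad event of \<open>Y\<close>
  at level \<open>\<epsilon>\<close> lies in that of \<open>X\<close> at level
  \<open>\<eta>\<close>.\<close>

lemma null_in_prob_le:
  assumes X: "null_in_prob M X"
    and le: "\<And>\<epsilon>. 0 < \<epsilon> \<Longrightarrow> \<exists>\<eta>>0. \<forall>n. \<forall>\<omega>\<in>space (M n). X n \<omega> \<le> ennreal \<eta> \<longrightarrow> Y n \<omega> \<le> ennreal \<epsilon>"
  shows "null_in_prob M Y"
  unfolding null_in_prob_def
proof (intro allI impI)
  fix \<epsilon> :: real assume "0 < \<epsilon>"
  from le[OF this] obtain \<eta> where \<eta>: "\<eta> > 0"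
    "\<And>n \<omega>. \<omega> \<in> space (M n) \<Longrightarrow> X n \<omega> \<le> ennreal \<eta> \<Longrightarrow> Y n \<omega> \<le> ennreal \<epsilon>" by blast
  have "outer_measure_of (M n) {\<omega>\<in>space (M n). ennreal \<epsilon> < Y n \<omega>}
      \<le> outer_measure_of (M n) {\<omega>\<in>space (M n). ennreal \<eta> < X n \<omega>}" for n
    using \<eta>(2) by (intro outer_measure_of_mono) (auto simp: not_le[symmetric])
  moreover have "(\<lambda>n. outer_measure_of (M n) {\<omega>\<in>space (M n). ennreal \<eta> < X n \<omega>}) \<longlonglongrightarrow> 0"
    using X \<eta>(1) by (simp add: null_in_prob_def)
  ultimately show "(\<lambda>n. outer_measure_of (M n) {\<omega>\<in>space (M n). ennreal \<epsilon> < Y n \<omega>}) \<longlonglongrightarrow> 0"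
    by (rule_tac tendsto_sandwich[where f = "\<lambda>_. 0"
          and h = "\<lambda>n. outer_measure_of (M n) {\<omega>\<in>space (M n). ennreal \<eta> < X n \<omega>}"]) auto
qed

lemma sup_norm_on_le_iff:
  "0 \<le> \<eta> \<Longrightarrow> sup_norm_on S f \<le> ennreal \<eta> \<longleftrightarrow> (\<forall>s\<in>S. \<bar>f s\<bar> \<le> \<eta>)"
  by (simp add: sup_norm_on_def SUP_le_iff)

text \<open>Provides an error level meeting the smallness conditions of
  \<open>grenander_error\<close>, depending only on \<open>C\<close>, \<open>\<kappa>\<close> and
  \<open>\<epsilon>\<close>.\<close>

lemma tolerance_exists:
  fixes C \<kappa> \<epsilon> :: real
  assumes "0 \<le> C" "0 < \<kappa>" "0 < \<epsilon>"
  obtains \<eta> where "0 < \<eta>" "4 * \<eta> \<le> \<kappa>" "(12 * C + 4 + 4 * \<epsilon>) * \<eta> \<le> \<kappa> * \<epsilon>"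
proof
  let ?d = "12 * C + 4 + 4 * \<epsilon>"
  let ?\<eta> = "min (\<kappa> / 4) (\<kappa> * \<epsilon> / ?d)"
  have d: "0 < ?d" using assms by linarith
  then show "0 < ?\<eta>" using assms by simp
  show "4 * ?\<eta> \<le> \<kappa>" by linarith
  have "?d * ?\<eta> \<le> ?d * (\<kappa> * \<epsilon> / ?d)" using d by (intro mult_left_mono) auto
  then show "?d * ?\<eta> \<le> \<kappa> * \<epsilon>" using d by simp
qed

theorem theorem1:
  fixes M :: "nat \<Rightarrow> 'a measure"
    and I :: "real set"
    and \<theta>\<^sub>0 \<Phi>\<^sub>0 \<Gamma>\<^sub>0 :: "real \<Rightarrow> real"
    and u\<^sub>0 :: real
    and u :: "nat \<Rightarrow> 'a \<Rightarrow> real"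
    and \<Phi> \<Gamma> \<theta> :: "nat \<Rightarrow> 'a \<Rightarrow> real \<Rightarrow> real"
    and J D Inv :: "nat \<Rightarrow> 'a \<Rightarrow> real set"
  assumes prob: "\<And>n. prob_space (M n)"
    and interval: "is_interval I"
    and theta0: "\<theta>\<^sub>0 \<in> cadlag_mono I"
    and u0: "0 < u\<^sub>0"
    and Phi0: "\<Phi>\<^sub>0 \<in> cadlag_mono_into I {0..u\<^sub>0}"
    and Gamma0: "\<Gamma>\<^sub>0 = primitive_fun I \<theta>\<^sub>0 \<Phi>\<^sub>0 \<circ> \<Phi>\<^sub>0"
    and J: "\<And>n \<omega>. J n \<omega> = {0..u n \<omega>}"
    and D: "\<And>n \<omega>. D n \<omega> = inv_dom I (J n \<omega>) (\<Phi> n \<omega>)"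
    and Inv: "\<And>n \<omega>. Inv n \<omega> = inv_range I (J n \<omega>) (\<Phi> n \<omega>)"
    and Phi: "\<And>n \<omega>. \<omega> \<in> space (M n) \<Longrightarrow> \<Phi> n \<omega> \<in> cadlag_mono_into I (J n \<omega>)"
    and Psi: "\<And>n \<omega>. \<omega> \<in> space (M n) \<Longrightarrow> comp_inv I (\<Gamma> n \<omega>) (\<Phi> n \<omega>) \<in> bounded_funs (D n \<omega>)"
    and theta: "\<And>n \<omega>. \<theta> n \<omega> = grenander I (J n \<omega>) (\<Gamma> n \<omega>) (\<Phi> n \<omega>)"
    and u: "null_in_prob M (\<lambda>n \<omega>. ennreal \<bar>u n \<omega> - u\<^sub>0\<bar>)"
  shows
    "(\<forall>x\<in>I. \<forall>\<delta>>0.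
        continuous (at x within I) \<theta>\<^sub>0 \<longrightarrow>
        {x-\<delta>..x+\<delta>} \<subseteq> {y\<in>I. \<Phi>\<^sub>0 y \<in> {0..u\<^sub>0}} \<longrightarrow>
        strict_mono_on {x-\<delta>..x+\<delta>} \<Phi>\<^sub>0 \<longrightarrow>
        continuous_on {x-\<delta>..x+\<delta>} \<Phi>\<^sub>0 \<longrightarrow>
        null_in_prob M (\<lambda>n \<omega>. sup_norm_on (Inv n \<omega>) (\<lambda>z. \<Gamma> n \<omega> z - \<Gamma>\<^sub>0 z)) \<longrightarrow>
        null_in_prob M (\<lambda>n \<omega>. sup_norm_on (Inv n \<omega>) (\<lambda>z. \<Phi> n \<omega> z - \<Phi>\<^sub>0 z)) \<longrightarrow>
        null_in_prob M (\<lambda>n \<omega>. sup_norm_on {x-\<delta>..x+\<delta>} (\<lambda>z. \<Phi> n \<omega> z - \<Phi>\<^sub>0 z)) \<longrightarrow>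
        (0 \<le> \<theta>\<^sub>0 x \<or>
         null_in_prob M (\<lambda>n \<omega>. sup_norm_on (D n \<omega>) (\<lambda>t. comp_inv I (\<Phi> n \<omega>) (\<Phi> n \<omega>) t - t))) \<longrightarrow>
        null_in_prob M (\<lambda>n \<omega>. ennreal \<bar>\<theta> n \<omega> x - \<theta>\<^sub>0 x\<bar>))
     \<and>
     (uniformly_continuous_on I \<theta>\<^sub>0 \<longrightarrow>
        uniformly_continuous_on I \<Phi>\<^sub>0 \<longrightarrow>
        strict_mono_on I \<Phi>\<^sub>0 \<longrightarrow>
        null_in_prob M (\<lambda>n \<omega>. sup_norm_on (Inv n \<omega>) (\<lambda>z. \<Gamma> n \<omega> z - \<Gamma>\<^sub>0 z)) \<longrightarrow>
        null_in_prob M (\<lambda>n \<omega>. sup_norm_on I (\<lambda>z. \<Phi> n \<omega> z - \<Phi>\<^sub>0 z)) \<longrightarrow>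
        bounded I \<longrightarrow>
        ((\<forall>y\<in>I. 0 \<le> \<theta>\<^sub>0 y) \<or> (\<forall>a\<in>I. (\<forall>y\<in>I. a \<le> y) \<longrightarrow> \<Phi>\<^sub>0 a = 0)) \<longrightarrow>
        (\<forall>\<beta>>0. null_in_prob M (\<lambda>n \<omega>.
           sup_norm_on (inner_set I \<Phi>\<^sub>0 (u n \<omega>) \<beta>) (\<lambda>x. \<theta> n \<omega> x - \<theta>\<^sub>0 x))))"
proof -
  have \<theta>0: "mono_on I \<theta>\<^sub>0" "bounded (\<theta>\<^sub>0 ` I)"
    using theta0 by (auto simp: cadlag_mono_def bounded_funs_def)
  have \<Phi>0: "mono_on I \<Phi>\<^sub>0" "\<Phi>\<^sub>0 ` I \<subseteq> {0..}"
    using Phi0 by (auto simp: cadlag_mono_into_def cadlag_mono_def)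
  have inc: "\<theta>\<^sub>0 w * (\<Phi>\<^sub>0 z - \<Phi>\<^sub>0 w) \<le> \<Gamma>\<^sub>0 z - \<Gamma>\<^sub>0 w \<and> \<Gamma>\<^sub>0 z - \<Gamma>\<^sub>0 w \<le> \<theta>\<^sub>0 z * (\<Phi>\<^sub>0 z - \<Phi>\<^sub>0 w)"
    if "w \<in> I" "z \<in> I" "w \<le> z" for w z
    using primitive_fun_increment[OF interval \<theta>0 \<Phi>0 that] by (simp add: Gamma0)
  note D = D[unfolded J] and Inv = Inv[unfolded J]
    and Phi = Phi[unfolded J] and theta = theta[unfolded J]
  have bdd: "comp_inv I (\<Gamma> n \<omega>) (\<Phi> n \<omega>) \<in> bounded_funs (inv_dom I {0..u n \<omega>} (\<Phi> n \<omega>))"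
    if "\<omega> \<in> space (M n)" for n \<omega>
    using Psi[OF that] by (simp add: D)
  note error = grenander_error[OF interval \<theta>0(1) \<Phi>0(1) inc Phi bdd]
  show ?thesis
  proof (intro conjI ballI allI impI)

    \<comment> \<open>Pointwise consistency\<close>
    fix x \<delta> :: real
    assume x: "x \<in> I" and \<delta>: "0 < \<delta>"
      and cont: "continuous (at x within I) \<theta>\<^sub>0"
      and sub: "{x-\<delta>..x+\<delta>} \<subseteq> {y\<in>I. \<Phi>\<^sub>0 y \<in> {0..u\<^sub>0}}"
      and strict: "strict_mono_on {x-\<delta>..x+\<delta>} \<Phi>\<^sub>0"
      and X1: "null_in_prob M (\<lambda>n \<omega>. sup_norm_on (Inv n \<omega>) (\<lambda>z. \<Gamma> n \<omega> z - \<Gamma>\<^sub>0 z))"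
      and X2: "null_in_prob M (\<lambda>n \<omega>. sup_norm_on (Inv n \<omega>) (\<lambda>z. \<Phi> n \<omega> z - \<Phi>\<^sub>0 z))"
      and X3: "null_in_prob M (\<lambda>n \<omega>. sup_norm_on {x-\<delta>..x+\<delta>} (\<lambda>z. \<Phi> n \<omega> z - \<Phi>\<^sub>0 z))"
      and alt: "0 \<le> \<theta>\<^sub>0 x \<or>
         null_in_prob M (\<lambda>n \<omega>. sup_norm_on (D n \<omega>) (\<lambda>t. comp_inv I (\<Phi> n \<omega>) (\<Phi> n \<omega>) t - t))"
    \<comment> \<open>Setting this error to \<open>0\<close> for a nonnegative slope lets one
      maximum of four null sequences serve both alternatives.\<close>
    define X4 where "X4 n \<omega> = (if 0 \<le> \<theta>\<^sub>0 x then 0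
      else sup_norm_on (D n \<omega>) (\<lambda>t. comp_inv I (\<Phi> n \<omega>) (\<Phi> n \<omega>) t - t))" for n \<omega>
    have "null_in_prob M X4"
      using alt by (cases "0 \<le> \<theta>\<^sub>0 x") (simp_all add: X4_def[abs_def] null_in_prob_def)
    note X = null_in_prob_max[OF X1 null_in_prob_max[OF X2 null_in_prob_max[OF X3 this]]]
    show "null_in_prob M (\<lambda>n \<omega>. ennreal \<bar>\<theta> n \<omega> x - \<theta>\<^sub>0 x\<bar>)"
    proof (rule null_in_prob_le[OF X])
      fix e :: real assume "0 < e"
      define \<epsilon> where "\<epsilon> = e / 2"
      have \<epsilon>: "0 < \<epsilon>" using \<open>0 < e\<close> by (simp add: \<epsilon>_def)
      obtain d where d: "d > 0" "\<And>y. y \<in> I \<Longrightarrow> dist y x < d \<Longrightarrow> dist (\<theta>\<^sub>0 y) (\<theta>\<^sub>0 x) < \<epsilon>"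
        using cont \<epsilon> unfolding continuous_within_eps_delta by metis
      define r where "r = min (d / 2) \<delta>"
      have r: "0 < r" "r < d" "r \<le> \<delta>" using d(1) \<delta> by (auto simp: r_def)
      \<comment> \<open>The three gaps belong to the choice \<open>a' = x - r\<close>,
        \<open>a = x - r / 2\<close>, \<open>b = x + r\<close> in the deterministic bound.\<close>
      define \<kappa> where "\<kappa> = Min {\<Phi>\<^sub>0 (x - r / 2) - \<Phi>\<^sub>0 (x - r), \<Phi>\<^sub>0 x - \<Phi>\<^sub>0 (x - r / 2), \<Phi>\<^sub>0 (x + r) - \<Phi>\<^sub>0 x}"
      have \<kappa>: "0 < \<kappa>"
        using r unfolding \<kappa>_def by (auto intro!: strict_mono_onD[OF strict])
      obtain \<eta> where \<eta>: "0 < \<eta>" "4 * \<eta> \<le> \<kappa>" "(12 * \<bar>\<theta>\<^sub>0 x\<bar> + 4 + 4 * \<epsilon>) * \<eta> \<le> \<kappa> * \<epsilon>"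
        using tolerance_exists[OF abs_ge_zero \<kappa> \<epsilon>] by blast
      have mem: "x - r \<in> I" "x + r \<in> I"
        using subsetD[OF sub, of "x - r"] subsetD[OF sub, of "x + r"] r by auto
      have osc: "\<theta>\<^sub>0 x - \<epsilon> \<le> \<theta>\<^sub>0 (x - r)" "\<theta>\<^sub>0 (x + r) \<le> \<theta>\<^sub>0 x + \<epsilon>"
        using d(2)[OF mem(1)] d(2)[OF mem(2)] r by (simp_all add: dist_real_def)
      show "\<exists>\<eta>>0. \<forall>n. \<forall>\<omega>\<in>space (M n).
        max (sup_norm_on (Inv n \<omega>) (\<lambda>z. \<Gamma> n \<omega> z - \<Gamma>\<^sub>0 z))
         (max (sup_norm_on (Inv n \<omega>) (\<lambda>z. \<Phi> n \<omega> z - \<Phi>\<^sub>0 z))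
           (max (sup_norm_on {x-\<delta>..x+\<delta>} (\<lambda>z. \<Phi> n \<omega> z - \<Phi>\<^sub>0 z)) (X4 n \<omega>))) \<le> ennreal \<eta>
        \<longrightarrow> ennreal \<bar>\<theta> n \<omega> x - \<theta>\<^sub>0 x\<bar> \<le> ennreal e"
      proof (intro exI[of _ \<eta>] conjI allI ballI impI \<eta>(1))
        fix n \<omega> assume \<omega>: "\<omega> \<in> space (M n)"
          and "max (sup_norm_on (Inv n \<omega>) (\<lambda>z. \<Gamma> n \<omega> z - \<Gamma>\<^sub>0 z))
         (max (sup_norm_on (Inv n \<omega>) (\<lambda>z. \<Phi> n \<omega> z - \<Phi>\<^sub>0 z))
           (max (sup_norm_on {x-\<delta>..x+\<delta>} (\<lambda>z. \<Phi> n \<omega> z - \<Phi>\<^sub>0 z)) (X4 n \<omega>))) \<le> ennreal \<eta>"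
        then have
          close: "\<And>z. z \<in> inv_range I {0..u n \<omega>} (\<Phi> n \<omega>) \<Longrightarrow> \<bar>\<Gamma> n \<omega> z - \<Gamma>\<^sub>0 z\<bar> \<le> \<eta>"
            "\<And>z. z \<in> inv_range I {0..u n \<omega>} (\<Phi> n \<omega>) \<Longrightarrow> \<bar>\<Phi> n \<omega> z - \<Phi>\<^sub>0 z\<bar> \<le> \<eta>"
            "\<And>z. z \<in> {x-\<delta>..x+\<delta>} \<Longrightarrow> \<bar>\<Phi> n \<omega> z - \<Phi>\<^sub>0 z\<bar> \<le> \<eta>"
          and X4: "X4 n \<omega> \<le> ennreal \<eta>"
          using \<eta>(1) by (simp_all add: sup_norm_on_le_iff Inv)
        have alt': "0 \<le> \<theta>\<^sub>0 x \<or> (\<forall>s\<in>inv_dom I {0..u n \<omega>} (\<Phi> n \<omega>).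
            comp_inv I (\<Phi> n \<omega>) (\<Phi> n \<omega>) s \<le> s + 2 * \<eta>)"
        proof (cases "0 \<le> \<theta>\<^sub>0 x")
          case False
          then have "\<forall>s\<in>D n \<omega>. \<bar>comp_inv I (\<Phi> n \<omega>) (\<Phi> n \<omega>) s - s\<bar> \<le> \<eta>"
            using X4 \<eta>(1) by (simp add: X4_def sup_norm_on_le_iff)
          then show ?thesis using \<eta>(1) unfolding D by fastforce
        qed simp
        have "\<bar>grenander I {0..u n \<omega>} (\<Gamma> n \<omega>) (\<Phi> n \<omega>) x - \<theta>\<^sub>0 x\<bar> \<le> 2 * \<epsilon>"
        proof (rule error[OF _ _ _ \<omega> \<omega> _ _ _ mem osc order_refl _ _ _ close(1,2) _ alt' \<epsilon> \<kappa> less_imp_le[OF \<eta>(1)] \<eta>(2,3)])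
          show "\<kappa> \<le> \<Phi>\<^sub>0 (x - r / 2) - \<Phi>\<^sub>0 (x - r)" "\<kappa> \<le> \<Phi>\<^sub>0 x - \<Phi>\<^sub>0 (x - r / 2)" "\<kappa> \<le> \<Phi>\<^sub>0 (x + r) - \<Phi>\<^sub>0 x"
            unfolding \<kappa>_def by (rule Min_le; simp)+
        qed (use r close(3) in auto)
        then show "ennreal \<bar>\<theta> n \<omega> x - \<theta>\<^sub>0 x\<bar> \<le> ennreal e"
          by (intro ennreal_leI) (simp add: theta \<epsilon>_def)
      qed
    qed
  next

    \<comment> \<open>Uniform consistency\<close>
    fix \<beta> :: real
    assume uc: "uniformly_continuous_on I \<theta>\<^sub>0" "uniformly_continuous_on I \<Phi>\<^sub>0"
      and strict: "strict_mono_on I \<Phi>\<^sub>0"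
      and X1: "null_in_prob M (\<lambda>n \<omega>. sup_norm_on (Inv n \<omega>) (\<lambda>z. \<Gamma> n \<omega> z - \<Gamma>\<^sub>0 z))"
      and X2: "null_in_prob M (\<lambda>n \<omega>. sup_norm_on I (\<lambda>z. \<Phi> n \<omega> z - \<Phi>\<^sub>0 z))"
      and bI: "bounded I"
      and alt: "(\<forall>y\<in>I. 0 \<le> \<theta>\<^sub>0 y) \<or> (\<forall>a\<in>I. (\<forall>y\<in>I. a \<le> y) \<longrightarrow> \<Phi>\<^sub>0 a = 0)"
      and \<beta>: "0 < \<beta>"
    obtain C where C: "0 < C" "\<And>x. x \<in> I \<Longrightarrow> \<bar>\<theta>\<^sub>0 x\<bar> \<le> C"
      using \<theta>0(2) by (auto simp: bounded_pos)
    show "null_in_prob M (\<lambda>n \<omega>. sup_norm_on (inner_set I \<Phi>\<^sub>0 (u n \<omega>) \<beta>) (\<lambda>x. \<theta> n \<omega> x - \<theta>\<^sub>0 x))"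
    proof (rule null_in_prob_le[OF null_in_prob_max[OF X1 X2]])
      fix e :: real assume "0 < e"
      define \<epsilon> where "\<epsilon> = e / 2"
      have \<epsilon>: "0 < \<epsilon>" using \<open>0 < e\<close> by (simp add: \<epsilon>_def)
      obtain d where d: "d > 0" "\<And>x y. x \<in> I \<Longrightarrow> y \<in> I \<Longrightarrow> dist y x < d \<Longrightarrow> dist (\<theta>\<^sub>0 y) (\<theta>\<^sub>0 x) < \<epsilon>"
        using uc(1) \<epsilon> unfolding uniformly_continuous_on_def by metis
      define r where "r = min (d / 2) \<beta>"
      have r: "0 < r" "r < d" "r \<le> \<beta>" using d(1) \<beta> by (auto simp: r_def)
      then have "0 < r / 2" by simp
      \<comment> \<open>One gap for all steps of length \<open>r / 2\<close>, together with the
        global bound \<open>C\<close>, makes \<open>\<eta>\<close> independent of \<open>x\<close>;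
        the points \<open>a'\<close>, \<open>a\<close>, \<open>b\<close> are chosen as in the
        pointwise case.\<close>
      then obtain \<kappa> where \<kappa>: "0 < \<kappa>" "\<And>x. x \<in> I \<Longrightarrow> x + r / 2 \<in> I \<Longrightarrow> \<kappa> \<le> \<Phi>\<^sub>0 (x + r / 2) - \<Phi>\<^sub>0 x"
        using strict_mono_on_uniform_gap[OF interval bI strict] by blast
      obtain \<eta> where \<eta>: "0 < \<eta>" "4 * \<eta> \<le> \<kappa>" "(12 * C + 4 + 4 * \<epsilon>) * \<eta> \<le> \<kappa> * \<epsilon>"
        using tolerance_exists[OF less_imp_le[OF C(1)] \<kappa>(1) \<epsilon>] by blast
      show "\<exists>\<eta>>0. \<forall>n. \<forall>\<omega>\<in>space (M n).
        max (sup_norm_on (Inv n \<omega>) (\<lambda>z. \<Gamma> n \<omega> z - \<Gamma>\<^sub>0 z))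
          (sup_norm_on I (\<lambda>z. \<Phi> n \<omega> z - \<Phi>\<^sub>0 z)) \<le> ennreal \<eta>
        \<longrightarrow> sup_norm_on (inner_set I \<Phi>\<^sub>0 (u n \<omega>) \<beta>) (\<lambda>x. \<theta> n \<omega> x - \<theta>\<^sub>0 x) \<le> ennreal e"
      proof (intro exI[of _ \<eta>] conjI allI ballI impI \<eta>(1))
        fix n \<omega> assume \<omega>: "\<omega> \<in> space (M n)"
          and "max (sup_norm_on (Inv n \<omega>) (\<lambda>z. \<Gamma> n \<omega> z - \<Gamma>\<^sub>0 z))
            (sup_norm_on I (\<lambda>z. \<Phi> n \<omega> z - \<Phi>\<^sub>0 z)) \<le> ennreal \<eta>"
        then have
          close: "\<And>z. z \<in> inv_range I {0..u n \<omega>} (\<Phi> n \<omega>) \<Longrightarrow> \<bar>\<Gamma> n \<omega> z - \<Gamma>\<^sub>0 z\<bar> \<le> \<eta>"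
            "\<And>z. z \<in> I \<Longrightarrow> \<bar>\<Phi> n \<omega> z - \<Phi>\<^sub>0 z\<bar> \<le> \<eta>"
          using \<eta>(1) by (simp_all add: sup_norm_on_le_iff Inv)
        have "\<bar>\<theta> n \<omega> x - \<theta>\<^sub>0 x\<bar> \<le> e" if "x \<in> inner_set I \<Phi>\<^sub>0 (u n \<omega>) \<beta>" for x
        proof -
          have x: "x \<in> I" "x - \<beta> \<in> I" "x + \<beta> \<in> I" using that by (auto simp: inner_set_def)
          have near: "y \<in> I" if "x - \<beta> \<le> y" "y \<le> x + \<beta>" for y
            using mem_is_interval_1_I[OF interval x(2,3) that] .
          have mem: "x - r \<in> I" "x + r \<in> I" "x - r / 2 \<in> I" "x + r / 2 \<in> I"
            using r by (auto intro!: near)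
          have osc: "\<theta>\<^sub>0 x - \<epsilon> \<le> \<theta>\<^sub>0 (x - r)" "\<theta>\<^sub>0 (x + r) \<le> \<theta>\<^sub>0 x + \<epsilon>"
            using d(2)[OF x(1) mem(1)] d(2)[OF x(1) mem(2)] r by (simp_all add: dist_real_def)
          have gap: "\<kappa> \<le> \<Phi>\<^sub>0 (x - r / 2) - \<Phi>\<^sub>0 (x - r)" "\<kappa> \<le> \<Phi>\<^sub>0 x - \<Phi>\<^sub>0 (x - r / 2)"
            "\<kappa> \<le> \<Phi>\<^sub>0 (x + r / 2) - \<Phi>\<^sub>0 x"
            using \<kappa>(2)[of "x - r"] \<kappa>(2)[of "x - r / 2"] \<kappa>(2)[of x] mem x(1) by simp_all
          have "\<Phi>\<^sub>0 (x + r / 2) \<le> \<Phi>\<^sub>0 (x + r)" using \<Phi>0(1) mem r by (auto simp: mono_on_def)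
          with gap(3) have gap': "\<kappa> \<le> \<Phi>\<^sub>0 (x + r) - \<Phi>\<^sub>0 x" by linarith
          \<comment> \<open>If \<open>\<theta>\<^sub>0\<close> may be negative, continuity of
            \<open>\<Phi>\<^sub>0\<close> and its vanishing at a least point of \<open>I\<close>
            bound the overshoot through \<open>comp_inv_self_le\<close>.\<close>
          have alt': "0 \<le> \<theta>\<^sub>0 x \<or> (\<forall>s\<in>inv_dom I {0..u n \<omega>} (\<Phi> n \<omega>).
            comp_inv I (\<Phi> n \<omega>) (\<Phi> n \<omega>) s \<le> s + 2 * \<eta>)"
            using alt x(1) comp_inv_self_le[OF interval uniformly_continuous_imp_continuous[OF uc(2)] close(2)]
            by blast
          have "\<bar>grenander I {0..u n \<omega>} (\<Gamma> n \<omega>) (\<Phi> n \<omega>) x - \<theta>\<^sub>0 x\<bar> \<le> 2 * \<epsilon>"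
            by (rule error[OF _ _ _ \<omega> \<omega> _ _ _ mem(1,2) osc C(2)[OF x(1)] gap(1,2) gap' close(1) _ _ alt'
                \<epsilon> \<kappa>(1) less_imp_le[OF \<eta>(1)] \<eta>(2,3)])
              (use r close(2) near in \<open>auto simp: inv_range_def\<close>)
          then show ?thesis by (simp add: theta \<epsilon>_def)
        qed
        then show "sup_norm_on (inner_set I \<Phi>\<^sub>0 (u n \<omega>) \<beta>) (\<lambda>x. \<theta> n \<omega> x - \<theta>\<^sub>0 x) \<le> ennreal e"
          using \<open>0 < e\<close> by (simp add: sup_norm_on_le_iff)
      qed
    qed
  qed
qed

end
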